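(* Let $(\mathcal{M},g)$ be a smooth Riemannian manifold with Levi-Civita connection $D$, and write $\langle X,Y\rangle=g(X,Y)$. Let $\varepsilon$ be a random function on $\mathcal{M}$ that is almost surely smooth. For every smooth vector field $X$ on $\mathcal{M}$ put $\widetilde X=\varepsilon X$, and for smooth vector fields $X,Y$ define $\widetilde D_XY:=D_{\widetilde X}\widetilde Y$. Then for all $a\in\mathbb{R}$, $f\in C^\infty(\mathcal{M})$ and all smooth vector fields $X,Y,Z$ on $\mathcal{M}$, the following hold almost surely: 1. $\widetilde D_{fX+Y}Z=f\widetilde D_XZ+\widetilde D_YZ$. 2. $\widetilde D_X(aY+Z)=a\widetilde D_XY+\widetilde D_XZ$. 3. $\widetilde D_X(fY)=f\widetilde D_XY+\widetilde X(f)\,\widetilde Y$. 4. $\widetilde D_XY-\widetilde D_YX-[\widetilde X,\widetilde Y]=0$. 5. $\langle\widetilde D_XY,\widetilde Z\rangle+\langle\widetilde Y,\widetilde D_XZ\rangle=\widetilde X\big(\langle\widetilde Y,\widetilde Z\rangle\big)$.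
   Context: For a vector field $V$ and a function $f$, $V(f)$ denotes the derivative of $f$ along $V$, and $[\cdot,\cdot]$ is the usual Lie bracket of vector fields. The quantities with tildes are random, being built from the random function $\varepsilon$; each identity is understood realization by realization of $\varepsilon$. *)

theory Defs
  imports "HOL-Probability.Probability_Measure" "HOL-Library.Function_Algebras"
begin

text \<open>
  A manifold of dimension \<open>n\<close> is a topology \<open>M\<close> together with an atlas of charts into the library's
  topological space \<open>Euclidean_space n\<close>, whose points are the functions \<open>nat \<Rightarrow> real\<close> vanishing
  from index \<open>n\<close> on. Sums, differences and \<open>0\<close> of functions are pointwise.
\<close>

text \<open>\<open>C_k_on n k S f\<close>: all partial derivatives of \<open>f\<close> of order at most \<open>k\<close> exist and are continuous
  on \<open>S\<close>; intended for open \<open>S\<close>.\<close>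

definition has_partial :: "nat \<Rightarrow> ((nat \<Rightarrow> real) \<Rightarrow> real) \<Rightarrow> (nat \<Rightarrow> real) \<Rightarrow> bool" where
  "has_partial i f x \<longleftrightarrow> (\<lambda>t. f (x(i := t))) field_differentiable at (x i)"

definition partial :: "nat \<Rightarrow> ((nat \<Rightarrow> real) \<Rightarrow> real) \<Rightarrow> (nat \<Rightarrow> real) \<Rightarrow> real" where
  "partial i f x = deriv (\<lambda>t. f (x(i := t))) (x i)"

primrec C_k_on :: "nat \<Rightarrow> nat \<Rightarrow> (nat \<Rightarrow> real) set \<Rightarrow> ((nat \<Rightarrow> real) \<Rightarrow> real) \<Rightarrow> bool" where
  "C_k_on n 0 S f \<longleftrightarrow> continuous_map (subtopology (Euclidean_space n) S) euclideanreal f"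
| "C_k_on n (Suc k) S f \<longleftrightarrow>
     continuous_map (subtopology (Euclidean_space n) S) euclideanreal f \<and>
     (\<forall>i<n. (\<forall>x\<in>S. has_partial i f x) \<and> C_k_on n k S (partial i f))"

definition C_inf_on :: "nat \<Rightarrow> (nat \<Rightarrow> real) set \<Rightarrow> ((nat \<Rightarrow> real) \<Rightarrow> real) \<Rightarrow> bool" where
  "C_inf_on n S f \<longleftrightarrow> (\<forall>k. C_k_on n k S f)"

type_synonym 'a chart = "'a set \<times> ('a \<Rightarrow> nat \<Rightarrow> real)"

definition second_countable_space :: "'a topology \<Rightarrow> bool" where
  "second_countable_space M \<longleftrightarrow>
     (\<exists>\<B>. countable \<B> \<and> (\<forall>V\<in>\<B>. openin M V) \<and>
          (\<forall>U x. openin M U \<and> x \<in> U \<longrightarrow> (\<exists>V\<in>\<B>. x \<in> V \<and> V \<subseteq> U)))"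

definition is_chart :: "nat \<Rightarrow> 'a topology \<Rightarrow> 'a chart \<Rightarrow> bool" where
  "is_chart n M = (\<lambda>(U, \<phi>). openin M U \<and> openin (Euclidean_space n) (\<phi> ` U) \<and>
     homeomorphic_map (subtopology M U) (subtopology (Euclidean_space n) (\<phi> ` U)) \<phi>)"

definition smooth_manifold :: "nat \<Rightarrow> 'a topology \<Rightarrow> 'a chart set \<Rightarrow> bool" where
  "smooth_manifold n M A \<longleftrightarrow>
     Hausdorff_space M \<and> second_countable_space M \<and>
     (\<forall>c\<in>A. is_chart n M c) \<and> (\<Union>c\<in>A. fst c) = topspace M \<and>
     (\<forall>(U, \<phi>)\<in>A. \<forall>(V, \<psi>)\<in>A. \<forall>i<n.
        C_inf_on n (\<phi> ` (U \<inter> V)) (\<lambda>x. \<psi> (inv_into U \<phi> x) i))"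

text \<open>The values outside \<open>topspace M\<close> of a function in \<open>smooth_functions n A\<close> are arbitrary.\<close>

definition smooth_functions :: "nat \<Rightarrow> 'a chart set \<Rightarrow> ('a \<Rightarrow> real) set" where
  "smooth_functions n A = {f. \<forall>(U, \<phi>)\<in>A. C_inf_on n (\<phi> ` U) (\<lambda>x. f (inv_into U \<phi> x))}"

text \<open>
  Tangent vectors at \<open>p\<close> are the derivations at \<open>p\<close> of the algebra of smooth functions. The last two
  clauses only serve to make the HOL function \<open>v\<close> a unique representative of the derivation: it
  ignores values outside \<open>topspace M\<close>, and it is \<open>0\<close> at arguments that are not smooth.
\<close>

definition tangent_space ::
  "nat \<Rightarrow> 'a topology \<Rightarrow> 'a chart set \<Rightarrow> 'a \<Rightarrow> (('a \<Rightarrow> real) \<Rightarrow> real) set" where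
  "tangent_space n M A p = {v.
     (\<forall>f\<in>smooth_functions n A. \<forall>h\<in>smooth_functions n A.
        (\<forall>a b. v (\<lambda>q. a * f q + b * h q) = a * v f + b * v h) \<and>
        v (\<lambda>q. f q * h q) = f p * v h + h p * v f \<and>
        ((\<forall>q\<in>topspace M. f q = h q) \<longrightarrow> v f = v h)) \<and>
     (\<forall>f. f \<notin> smooth_functions n A \<longrightarrow> v f = 0)}"

type_synonym 'a vfield = "'a \<Rightarrow> ('a \<Rightarrow> real) \<Rightarrow> real"

definition vderiv :: "'a vfield \<Rightarrow> ('a \<Rightarrow> real) \<Rightarrow> 'a \<Rightarrow> real" where
  "vderiv X f = (\<lambda>p. X p f)"

text \<open>Smooth vector fields; extended by \<open>0\<close> outside \<open>topspace M\<close>, so that two of them agree on the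
  manifold iff they are equal.\<close>

definition vector_fields :: "nat \<Rightarrow> 'a topology \<Rightarrow> 'a chart set \<Rightarrow> 'a vfield set" where
  "vector_fields n M A = {X.
     (\<forall>p\<in>topspace M. X p \<in> tangent_space n M A p) \<and>
     (\<forall>p. p \<notin> topspace M \<longrightarrow> X p = 0) \<and>
     (\<forall>f\<in>smooth_functions n A. vderiv X f \<in> smooth_functions n A)}"

definition vscale :: "('a \<Rightarrow> real) \<Rightarrow> 'a vfield \<Rightarrow> 'a vfield" (infixr "*\<^sub>V" 70) where
  "f *\<^sub>V X = (\<lambda>p h. f p * X p h)"

definition lie_bracket :: "'a vfield \<Rightarrow> 'a vfield \<Rightarrow> 'a vfield" where
  "lie_bracket X Y = (\<lambda>p f. X p (vderiv Y f) - Y p (vderiv X f))"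

type_synonym 'a metric_tensor =
  "'a \<Rightarrow> (('a \<Rightarrow> real) \<Rightarrow> real) \<Rightarrow> (('a \<Rightarrow> real) \<Rightarrow> real) \<Rightarrow> real"

definition metric_apply :: "'a metric_tensor \<Rightarrow> 'a vfield \<Rightarrow> 'a vfield \<Rightarrow> 'a \<Rightarrow> real" where
  "metric_apply g X Y = (\<lambda>p. g p (X p) (Y p))"

definition riemannian_metric ::
  "nat \<Rightarrow> 'a topology \<Rightarrow> 'a chart set \<Rightarrow> 'a metric_tensor \<Rightarrow> bool" where
  "riemannian_metric n M A g \<longleftrightarrow>
     (\<forall>p\<in>topspace M. \<forall>u\<in>tangent_space n M A p. \<forall>v\<in>tangent_space n M A p.
        g p u v = g p v u \<and>
        (u \<noteq> 0 \<longrightarrow> g p u u > 0) \<and>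
        (\<forall>w\<in>tangent_space n M A p. \<forall>a b.
           g p (\<lambda>f. a * u f + b * v f) w = a * g p u w + b * g p v w)) \<and>
     (\<forall>X\<in>vector_fields n M A. \<forall>Y\<in>vector_fields n M A.
        metric_apply g X Y \<in> smooth_functions n A)"

definition affine_connection ::
  "nat \<Rightarrow> 'a topology \<Rightarrow> 'a chart set \<Rightarrow> ('a vfield \<Rightarrow> 'a vfield \<Rightarrow> 'a vfield) \<Rightarrow> bool" where
  "affine_connection n M A D \<longleftrightarrow>
     (\<forall>X\<in>vector_fields n M A. \<forall>Y\<in>vector_fields n M A. D X Y \<in> vector_fields n M A) \<and>
     (\<forall>X\<in>vector_fields n M A. \<forall>Y\<in>vector_fields n M A. \<forall>Z\<in>vector_fields n M A.
        (\<forall>f\<in>smooth_functions n A. D (f *\<^sub>V X + Y) Z = f *\<^sub>V D X Z + D Y Z) \<and>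
        (\<forall>a. D X ((\<lambda>_. a) *\<^sub>V Y + Z) = (\<lambda>_. a) *\<^sub>V D X Y + D X Z) \<and>
        (\<forall>f\<in>smooth_functions n A. D X (f *\<^sub>V Y) = f *\<^sub>V D X Y + vderiv X f *\<^sub>V Y))"

definition levi_civita ::
  "nat \<Rightarrow> 'a topology \<Rightarrow> 'a chart set \<Rightarrow> 'a metric_tensor \<Rightarrow>
   ('a vfield \<Rightarrow> 'a vfield \<Rightarrow> 'a vfield) \<Rightarrow> bool" where
  "levi_civita n M A g D \<longleftrightarrow>
     affine_connection n M A D \<and>
     (\<forall>X\<in>vector_fields n M A. \<forall>Y\<in>vector_fields n M A.
        D X Y - D Y X = lie_bracket X Y) \<and>
     (\<forall>X\<in>vector_fields n M A. \<forall>Y\<in>vector_fields n M A. \<forall>Z\<in>vector_fields n M A.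
        \<forall>p\<in>topspace M. vderiv X (metric_apply g Y Z) p =
          metric_apply g (D X Y) Z p + metric_apply g Y (D X Z) p)"

definition random_function :: "'w measure \<Rightarrow> 'a topology \<Rightarrow> ('w \<Rightarrow> 'a \<Rightarrow> real) \<Rightarrow> bool" where
  "random_function P M \<epsilon> \<longleftrightarrow>
     prob_space P \<and> (\<forall>p\<in>topspace M. (\<lambda>\<omega>. \<epsilon> \<omega> p) \<in> borel_measurable P)"

text \<open>For a realization \<open>e\<close> of the random function, the perturbed field is \<open>e *\<^sub>V X\<close>, and the perturbed
  connection is the following.\<close>

definition Dtilde ::
  "('a vfield \<Rightarrow> 'a vfield \<Rightarrow> 'a vfield) \<Rightarrow> ('a \<Rightarrow> real) \<Rightarrow> 'a vfield \<Rightarrow> 'a vfield \<Rightarrow> 'a vfield" where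
  "Dtilde D e X Y = D (e *\<^sub>V X) (e *\<^sub>V Y)"

end

theory Submission
  imports Defs
begin

text \<open>
  Each identity holds for every realization \<open>e\<close> of the random function that is smooth. Scaling by
  \<open>e\<close> is \<open>C\<^sup>\<infinity>\<close>-linear, and a smooth \<open>e\<close> turns vector fields into vector fields. So all five claims are
  the defining properties of the Levi-Civita connection \<open>D\<close>, read at the fields \<open>e *\<^sub>V X\<close>,
  \<open>e *\<^sub>V Y\<close>, \<open>e *\<^sub>V Z\<close>, once \<open>e\<close> is moved past \<open>f\<close>, \<open>a\<close> and the sums. In the product rule
  \<open>e\<close> is never differentiated separately: \<open>e *\<^sub>V (f *\<^sub>V Y)\<close> is read as \<open>f *\<^sub>V (e *\<^sub>V Y)\<close>, and the
  derivative of \<open>e\<close> stays inside \<open>Dtilde D e X Y\<close>.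

  What needs work is the closure of vector fields under scaling
  (\<open>vscale_vector_field\<close>). Pointwise it is immediate, but \<open>e *\<^sub>V X\<close> must again send smooth
  functions to smooth functions, which requires that products of smooth functions are smooth. In
  charts this is the Leibniz rule, iterated over the order of differentiation (\<open>C_k_on_mult\<close>).
  The image of a chart is open, so partial derivatives at its points are determined by the values of
  the function on it (\<open>C_k_on_cong\<close>); this allows replacing the partial derivative of a product, at
  every stage of the induction, by the Leibniz expression.
\<close>

text \<open>Openness in \<open>Euclidean_space n\<close> controls only points that vanish from index \<open>n\<close> on, whence
  the restriction to the first \<open>n\<close> directions.\<close>

lemma eventually_fun_upd_in_open:
  assumes S: "openin (Euclidean_space n) S" and x: "x \<in> S" and i: "i < n"
  shows "\<forall>\<^sub>F t in nhds (x i). x(i := t) \<in> S"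
proof -
  have top: "x \<in> topspace (Euclidean_space n)"
    using S x openin_subset by blast
  have "continuous_map euclideanreal (Euclidean_space n) (\<lambda>t. x(i := t))"
    using top i
    by (auto simp: Euclidean_space_def continuous_map_in_subtopology
        continuous_map_componentwise_UNIV fun_upd_def)
  then have "open {t. x(i := t) \<in> S}"
    using openin_continuous_map_preimage[OF _ S] by fastforce
  then show ?thesis
    using x eventually_nhds_in_open[of "{t. x(i := t) \<in> S}" "x i"] by simp
qed

lemma
  assumes S: "openin (Euclidean_space n) S" and x: "x \<in> S" and i: "i < n"
    and eq: "\<And>y. y \<in> S \<Longrightarrow> f y = g y"
  shows has_partial_cong: "has_partial i f x \<Longrightarrow> has_partial i g x"
    and partial_cong: "partial i f x = partial i g x"
proof -
  have ev: "\<forall>\<^sub>F t in nhds (x i). f (x(i := t)) = g (x(i := t))"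
    using eventually_fun_upd_in_open[OF S x i] by (rule eventually_mono) (rule eq)
  show "partial i f x = partial i g x"
    unfolding partial_def by (rule deriv_cong_ev[OF ev refl])
  show "has_partial i g x" if "has_partial i f x"
    using that DERIV_cong_ev[OF refl ev refl]
    unfolding has_partial_def field_differentiable_def by blast
qed

lemma C_k_on_cong:
  assumes S: "openin (Euclidean_space n) S"
  shows "C_k_on n k S f \<Longrightarrow> (\<And>x. x \<in> S \<Longrightarrow> f x = g x) \<Longrightarrow> C_k_on n k S g"
proof (induction k arbitrary: f g)
  case 0
  then show ?case
    by (auto elim: continuous_map_eq)
next
  case (Suc k)
  have "continuous_map (subtopology (Euclidean_space n) S) euclideanreal g"
    using Suc.prems by (auto elim: continuous_map_eq)
  moreover have "has_partial i g x" if "i < n" "x \<in> S" for i x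
    using Suc.prems that by (auto intro: has_partial_cong[OF S, of x i f g])
  moreover have "C_k_on n k S (partial i g)" if "i < n" for i
  proof (rule Suc.IH)
    show "C_k_on n k S (partial i f)"
      using Suc.prems that by simp
    show "partial i f x = partial i g x" if "x \<in> S" for x
      using partial_cong[OF S that \<open>i < n\<close>] Suc.prems by blast
  qed
  ultimately show ?case
    by simp
qed

lemma C_k_on_SucD: "C_k_on n (Suc k) S f \<Longrightarrow> C_k_on n k S f"
proof (induction k arbitrary: f)
  case (Suc k)
  then show ?case
    by (subst C_k_on.simps(2)) (meson C_k_on.simps(2))
qed simp

lemma
  assumes "has_partial i f x" "has_partial i g x"
  shows has_partial_add: "has_partial i (\<lambda>y. f y + g y) x"
    and partial_add: "partial i (\<lambda>y. f y + g y) x = partial i f x + partial i g x"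
    and has_partial_mult: "has_partial i (\<lambda>y. f y * g y) x"
    and partial_mult: "partial i (\<lambda>y. f y * g y) x = f x * partial i g x + partial i f x * g x"
  using assms unfolding has_partial_def partial_def
  by (simp_all add: field_differentiable_add field_differentiable_mult)

lemma C_k_on_add:
  assumes S: "openin (Euclidean_space n) S"
  shows "C_k_on n k S f \<Longrightarrow> C_k_on n k S g \<Longrightarrow> C_k_on n k S (\<lambda>x. f x + g x)"
proof (induction k arbitrary: f g)
  case 0
  then show ?case
    by (simp add: continuous_map_add)
next
  case (Suc k)
  have "C_k_on n k S (partial i (\<lambda>x. f x + g x))" if "i < n" for i
  proof (rule C_k_on_cong[OF S])
    show "C_k_on n k S (\<lambda>x. partial i f x + partial i g x)"
      using Suc that by simp
    show "partial i f x + partial i g x = partial i (\<lambda>x. f x + g x) x" if "x \<in> S" for x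
      using Suc.prems that \<open>i < n\<close> by (simp add: partial_add)
  qed
  then show ?case
    using Suc.prems by (auto intro: continuous_map_add has_partial_add)
qed

text \<open>Differentiating a product once yields products of one function with one derivative of the
  other, so a product of order \<open>Suc k\<close> reduces to products of order \<open>k\<close>; the undifferentiated
  factors are used at the lower order.\<close>

lemma C_k_on_mult:
  assumes S: "openin (Euclidean_space n) S"
  shows "C_k_on n k S f \<Longrightarrow> C_k_on n k S g \<Longrightarrow> C_k_on n k S (\<lambda>x. f x * g x)"
proof (induction k arbitrary: f g)
  case 0
  then show ?case
    by (simp add: continuous_map_real_mult)
next
  case (Suc k)
  have "C_k_on n k S (partial i (\<lambda>x. f x * g x))" if "i < n" for i
  proof (rule C_k_on_cong[OF S])
    have "C_k_on n k S f" "C_k_on n k S g"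
      using Suc.prems C_k_on_SucD by blast+
    moreover have "C_k_on n k S (partial i f)" "C_k_on n k S (partial i g)"
      using Suc.prems that by simp_all
    ultimately show "C_k_on n k S (\<lambda>x. f x * partial i g x + partial i f x * g x)"
      by (intro C_k_on_add[OF S] Suc.IH)
    show "f x * partial i g x + partial i f x * g x = partial i (\<lambda>x. f x * g x) x"
      if "x \<in> S" for x
      using Suc.prems that \<open>i < n\<close> by (simp add: partial_mult)
  qed
  then show ?case
    using Suc.prems by (auto intro: continuous_map_real_mult has_partial_mult)
qed

lemma smooth_functions_mult:
  assumes "smooth_manifold n M A" "f \<in> smooth_functions n A" "h \<in> smooth_functions n A"
  shows "(\<lambda>p. f p * h p) \<in> smooth_functions n A"
proof -
  have "C_inf_on n (\<phi> ` U) (\<lambda>x. f (inv_into U \<phi> x) * h (inv_into U \<phi> x))"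
    if "(U, \<phi>) \<in> A" for U \<phi>
  proof -
    have "is_chart n M (U, \<phi>)"
      using assms(1) that unfolding smooth_manifold_def by (elim conjE bspec)
    then have "openin (Euclidean_space n) (\<phi> ` U)"
      by (simp add: is_chart_def)
    moreover have "C_inf_on n (\<phi> ` U) (\<lambda>x. f (inv_into U \<phi> x))"
        "C_inf_on n (\<phi> ` U) (\<lambda>x. h (inv_into U \<phi> x))"
      using assms(2,3) that unfolding smooth_functions_def by auto
    ultimately show ?thesis
      by (simp add: C_inf_on_def C_k_on_mult)
  qed
  then show ?thesis
    unfolding smooth_functions_def by blast
qed

lemma vscale_tangent_space:
  assumes "X p \<in> tangent_space n M A p"
  shows "(f *\<^sub>V X) p \<in> tangent_space n M A p"
  unfolding tangent_space_def
proof (intro CollectI conjI ballI allI impI)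
  fix h k :: "'a \<Rightarrow> real" and a b :: real
  assume hk: "h \<in> smooth_functions n A" "k \<in> smooth_functions n A"
  have "X p (\<lambda>q. a * h q + b * k q) = a * X p h + b * X p k"
    using assms hk unfolding tangent_space_def by blast
  then show "(f *\<^sub>V X) p (\<lambda>q. a * h q + b * k q) = a * (f *\<^sub>V X) p h + b * (f *\<^sub>V X) p k"
    by (simp add: vscale_def algebra_simps)
  have "X p (\<lambda>q. h q * k q) = h p * X p k + k p * X p h"
    using assms hk unfolding tangent_space_def by blast
  then show "(f *\<^sub>V X) p (\<lambda>q. h q * k q) = h p * (f *\<^sub>V X) p k + k p * (f *\<^sub>V X) p h"
    by (simp add: vscale_def algebra_simps)
  assume "\<forall>q\<in>topspace M. h q = k q"
  then have "X p h = X p k"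
    using assms hk unfolding tangent_space_def by blast
  then show "(f *\<^sub>V X) p h = (f *\<^sub>V X) p k"
    by (simp add: vscale_def)
next
  fix h
  assume "h \<notin> smooth_functions n A"
  then have "X p h = 0"
    using assms unfolding tangent_space_def by blast
  then show "(f *\<^sub>V X) p h = 0"
    by (simp add: vscale_def)
qed

lemma vscale_vector_field:
  assumes "smooth_manifold n M A" "f \<in> smooth_functions n A" "X \<in> vector_fields n M A"
  shows "f *\<^sub>V X \<in> vector_fields n M A"
proof -
  have "vderiv (f *\<^sub>V X) h = (\<lambda>p. f p * vderiv X h p)" for h
    by (simp add: vderiv_def vscale_def)
  moreover have "(f *\<^sub>V X) p = 0" if "X p = 0" for p
    using that by (simp add: vscale_def fun_eq_iff)
  ultimately show ?thesis
    using assms(3) unfolding vector_fields_def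
    by (simp add: vscale_tangent_space smooth_functions_mult[OF assms(1,2)])
qed

lemma vscale_linear: "e *\<^sub>V (f *\<^sub>V X + Y) = f *\<^sub>V (e *\<^sub>V X) + e *\<^sub>V Y"
  by (simp add: vscale_def fun_eq_iff algebra_simps)

lemma vscale_left_commute: "e *\<^sub>V (f *\<^sub>V X) = f *\<^sub>V (e *\<^sub>V X)"
  by (simp add: vscale_def fun_eq_iff)

theorem theorem1:
  fixes n :: nat and M :: "'a topology" and A :: "'a chart set"
    and g :: "'a metric_tensor" and D :: "'a vfield \<Rightarrow> 'a vfield \<Rightarrow> 'a vfield"
    and P :: "'w measure" and \<epsilon> :: "'w \<Rightarrow> 'a \<Rightarrow> real"
    and a :: real and f :: "'a \<Rightarrow> real" and X Y Z :: "'a vfield"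
  assumes "smooth_manifold n M A"
    and "riemannian_metric n M A g"
    and "levi_civita n M A g D"
    and "random_function P M \<epsilon>"
    and "AE \<omega> in P. \<epsilon> \<omega> \<in> smooth_functions n A"
    and "f \<in> smooth_functions n A"
    and "X \<in> vector_fields n M A"
    and "Y \<in> vector_fields n M A"
    and "Z \<in> vector_fields n M A"
  shows "AE \<omega> in P.
      Dtilde D (\<epsilon> \<omega>) (f *\<^sub>V X + Y) Z
        = f *\<^sub>V Dtilde D (\<epsilon> \<omega>) X Z + Dtilde D (\<epsilon> \<omega>) Y Z
    \<and> Dtilde D (\<epsilon> \<omega>) X ((\<lambda>_. a) *\<^sub>V Y + Z)
        = (\<lambda>_. a) *\<^sub>V Dtilde D (\<epsilon> \<omega>) X Y + Dtilde D (\<epsilon> \<omega>) X Z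
    \<and> Dtilde D (\<epsilon> \<omega>) X (f *\<^sub>V Y)
        = f *\<^sub>V Dtilde D (\<epsilon> \<omega>) X Y + vderiv (\<epsilon> \<omega> *\<^sub>V X) f *\<^sub>V (\<epsilon> \<omega> *\<^sub>V Y)
    \<and> Dtilde D (\<epsilon> \<omega>) X Y - Dtilde D (\<epsilon> \<omega>) Y X - lie_bracket (\<epsilon> \<omega> *\<^sub>V X) (\<epsilon> \<omega> *\<^sub>V Y) = 0
    \<and> (\<forall>p\<in>topspace M.
         metric_apply g (Dtilde D (\<epsilon> \<omega>) X Y) (\<epsilon> \<omega> *\<^sub>V Z) p
           + metric_apply g (\<epsilon> \<omega> *\<^sub>V Y) (Dtilde D (\<epsilon> \<omega>) X Z) p
         = vderiv (\<epsilon> \<omega> *\<^sub>V X) (metric_apply g (\<epsilon> \<omega> *\<^sub>V Y) (\<epsilon> \<omega> *\<^sub>V Z)) p)"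
  using assms(5)
proof (rule AE_mp, intro AE_I2 impI)
  fix \<omega>
  let ?e = "\<epsilon> \<omega>"
  assume "?e \<in> smooth_functions n A"
  then have V: "?e *\<^sub>V X \<in> vector_fields n M A" "?e *\<^sub>V Y \<in> vector_fields n M A"
      "?e *\<^sub>V Z \<in> vector_fields n M A"
    using assms(1,7-9) vscale_vector_field by blast+
  have conn: "affine_connection n M A D"
    using assms(3) unfolding levi_civita_def by blast
  have "Dtilde D ?e (f *\<^sub>V X + Y) Z = f *\<^sub>V Dtilde D ?e X Z + Dtilde D ?e Y Z"
    using conn V assms(6) unfolding Dtilde_def vscale_linear affine_connection_def by blast
  moreover have "Dtilde D ?e X ((\<lambda>_. a) *\<^sub>V Y + Z)
      = (\<lambda>_. a) *\<^sub>V Dtilde D ?e X Y + Dtilde D ?e X Z"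
    using conn V unfolding Dtilde_def vscale_linear affine_connection_def by blast
  moreover have "Dtilde D ?e X (f *\<^sub>V Y)
      = f *\<^sub>V Dtilde D ?e X Y + vderiv (?e *\<^sub>V X) f *\<^sub>V (?e *\<^sub>V Y)"
    using conn V assms(6)
    unfolding Dtilde_def vscale_left_commute[of ?e f] affine_connection_def by blast
  moreover have "Dtilde D ?e X Y - Dtilde D ?e Y X - lie_bracket (?e *\<^sub>V X) (?e *\<^sub>V Y) = 0"
    using assms(3) V unfolding Dtilde_def levi_civita_def by simp
  moreover have "metric_apply g (Dtilde D ?e X Y) (?e *\<^sub>V Z) p
        + metric_apply g (?e *\<^sub>V Y) (Dtilde D ?e X Z) p
      = vderiv (?e *\<^sub>V X) (metric_apply g (?e *\<^sub>V Y) (?e *\<^sub>V Z)) p"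
    if "p \<in> topspace M" for p
    using assms(3) V that unfolding Dtilde_def levi_civita_def by simp
  ultimately show "Dtilde D ?e (f *\<^sub>V X + Y) Z
        = f *\<^sub>V Dtilde D ?e X Z + Dtilde D ?e Y Z
    \<and> Dtilde D ?e X ((\<lambda>_. a) *\<^sub>V Y + Z)
        = (\<lambda>_. a) *\<^sub>V Dtilde D ?e X Y + Dtilde D ?e X Z
    \<and> Dtilde D ?e X (f *\<^sub>V Y)
        = f *\<^sub>V Dtilde D ?e X Y + vderiv (?e *\<^sub>V X) f *\<^sub>V (?e *\<^sub>V Y)
    \<and> Dtilde D ?e X Y - Dtilde D ?e Y X - lie_bracket (?e *\<^sub>V X) (?e *\<^sub>V Y) = 0
    \<and> (\<forall>p\<in>topspace M.
         metric_apply g (Dtilde D ?e X Y) (?e *\<^sub>V Z) p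
           + metric_apply g (?e *\<^sub>V Y) (Dtilde D ?e X Z) p
         = vderiv (?e *\<^sub>V X) (metric_apply g (?e *\<^sub>V Y) (?e *\<^sub>V Z)) p)" by blast
qed

end
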